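(* Let $\Delta$ be the open unit disc in $\mathbb C$ and $I$ the interval $]-1,1[$. The function $$u(z)=|\operatorname{Im}(\operatorname{arctanh}(z))|$$ is maximal in $\mathcal U(I,\Delta)$. Moreover, for every $x\in I$ and $\xi\in\mathbb R=T_xI$ one has $$E_{I,\Delta}(x,\xi)=\frac{|\xi|}{1-x^2}.$$
   Context: $\operatorname{arctanh}(z)=\frac12\log\frac{1+z}{1-z}$ (principal branch) on $\Delta$. For a complex manifold $M$ of complex dimension $n$ with complex structure $J$ on $TM$, and a closed totally real analytic submanifold $V\subset M$ of real dimension $n$ (here $M=\Delta$, $V=I$, $n=1$, $J\xi=i\xi$), $\mathcal U(V,M)$ is the class of all plurisubharmonic functions $u:M\to[0,\pi/4[$ with $u=0$ on $V$. A function $u\in\mathcal U(V,M)$ is maximal if $v\le u$ on $M$ for every $v\in\mathcal U(V,M)$, $u>0$ on $M\setminus V$, and $\sup_Mu=\pi/4$. For $p\in M$, $\eta\in T_pM$, $\Gamma_M(p,\eta)$ is the set of $C^1$ maps $\gamma:\,]-\varepsilon,\varepsilon[\,\to M$ (for some $\varepsilon>0$) with $\gamma(0)=p$, $\gamma'(0)=\eta$. For $p\in V$, $\xi\in T_pV$, $u\in\mathcal U(V,M)$, $$E_{u,M}(p,\xi)=\inf_{\gamma\in\Gamma_M(p,J\xi)}\limsup_{t\to0^+}\frac{u(\gamma(t))}{t},\qquad E_{V,M}(p,\xi)=\sup_{u\in\mathcal U(V,M)}E_{u,M}(p,\xi).$$ *)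

theory Defs
  imports "HOL-Analysis.Analysis"
begin

text \<open>
  Throughout, the complex manifold is an open set \<open>M\<close> of complex numbers (complex dimension 1),
  every tangent space is identified with \<^typ>\<open>complex\<close>, and the complex structure \<open>J\<close> is
  multiplication by \<^term>\<open>\<i>\<close>.  A function on \<open>M\<close> is a total function of which only the
  values on \<open>M\<close> matter.
\<close>

definition upper_semicontinuous_on :: "complex set \<Rightarrow> (complex \<Rightarrow> real) \<Rightarrow> bool" where
  "upper_semicontinuous_on M u \<longleftrightarrow>
     (\<forall>z\<in>M. \<forall>c. u z < c \<longrightarrow> (\<forall>\<^sub>F w in at z within M. u w < c))"

text \<open>
  Only finite-valued functions are considered.  For these, the integrability clause is part of the
  meaning of the sub-mean-value inequality: an upper semicontinuous function is measurable and
  bounded above on a circle, so its mean is well defined in \<open>[-\<infinity>, \<infinity>[\<close>, and the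
  inequality forces this mean to be finite.  The clause is needed because \<^const>\<open>integral\<close> is
  0 for non-integrable functions; it holds automatically for bounded functions.
\<close>

definition plurisubharmonic_on :: "complex set \<Rightarrow> (complex \<Rightarrow> real) \<Rightarrow> bool" where
  "plurisubharmonic_on M u \<longleftrightarrow>
     upper_semicontinuous_on M u \<and>
     (\<forall>a b. (\<forall>\<zeta>\<in>cball 0 1. a + \<zeta> * b \<in> M) \<longrightarrow>
        (\<lambda>\<theta>. u (a + cis \<theta> * b)) absolutely_integrable_on {0..2 * pi} \<and>
        u a \<le> 1 / (2 * pi) * integral {0..2 * pi} (\<lambda>\<theta>. u (a + cis \<theta> * b)))"

definition U_class :: "complex set \<Rightarrow> complex set \<Rightarrow> (complex \<Rightarrow> real) set" where
  "U_class V M =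
     {u. plurisubharmonic_on M u \<and> u ` M \<subseteq> {0..<pi / 4} \<and> (\<forall>z\<in>V. u z = 0)}"

definition maximal_in_U :: "complex set \<Rightarrow> complex set \<Rightarrow> (complex \<Rightarrow> real) \<Rightarrow> bool" where
  "maximal_in_U V M u \<longleftrightarrow>
     u \<in> U_class V M \<and>
     (\<forall>v\<in>U_class V M. \<forall>z\<in>M. v z \<le> u z) \<and>
     (\<forall>z\<in>M - V. 0 < u z) \<and>
     (SUP z\<in>M. u z) = pi / 4"

text \<open>
  The interval of definition depends on the curve; outside it the values of the total
  function \<open>\<gamma>\<close> are irrelevant.
\<close>

definition curves :: "complex set \<Rightarrow> complex \<Rightarrow> complex \<Rightarrow> (real \<Rightarrow> complex) set" where
  "curves M p \<eta> =
     {\<gamma>. \<exists>\<epsilon>>0. \<gamma> C1_differentiable_on {-\<epsilon><..<\<epsilon>} \<and> \<gamma> ` {-\<epsilon><..<\<epsilon>} \<subseteq> M \<and>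
          \<gamma> 0 = p \<and> (\<gamma> has_vector_derivative \<eta>) (at 0)}"

definition E_fun :: "(complex \<Rightarrow> real) \<Rightarrow> complex set \<Rightarrow> complex \<Rightarrow> complex \<Rightarrow> ereal" where
  "E_fun u M p \<xi> =
     (INF \<gamma>\<in>curves M p (\<i> * \<xi>). Limsup (at_right 0) (\<lambda>t. ereal (u (\<gamma> t) / t)))"

definition E_metric :: "complex set \<Rightarrow> complex set \<Rightarrow> complex \<Rightarrow> complex \<Rightarrow> ereal" where
  "E_metric V M p \<xi> = (SUP u\<in>U_class V M. E_fun u M p \<xi>)"

abbreviation unit_disc :: "complex set" where
  "unit_disc \<equiv> ball 0 1"

abbreviation real_interval :: "complex set" where
  "real_interval \<equiv> complex_of_real ` {-1<..<1}"

end

theory Submission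
  imports Defs "HOL-Complex_Analysis.Cauchy_Integral_Formula"
begin

text \<open>
  The Cayley map \<open>(1 + z) / (1 - z)\<close> sends the disc to the right half-plane, so \<open>u = \<bar>Im artanh\<bar>\<close>
  is half the modulus of an angle in \<open>]-\<pi>/2, \<pi>/2[\<close>; it vanishes on the real diameter and equals
  \<open>\<pi>/4\<close> on the rest of the unit circle.  A competitor \<open>v\<close> is compared with the dilate \<open>u(z / r)\<close>,
  \<open>r < 1\<close>, on \<open>\<bar>z\<bar> \<le> r\<close>: off the real axis the dilate is harmonic, and on the boundary
  \<open>v \<le> u(z / r)\<close>, the exceptional points \<open>r\<close> and \<open>-r\<close> being harmless because \<open>v\<close> is upper
  semicontinuous and vanishes there.  Letting \<open>r\<close> tend to \<open>1\<close> gives \<open>v \<le> u\<close>.  Hence the supremum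
  defining \<open>E\<close> is attained at \<open>u\<close>, for which every admissible curve gives the same limit, by the chain rule
  and \<open>artanh' x = 1 / (1 - x\<^sup>2)\<close>.
\<close>

section \<open>Upper semicontinuous functions\<close>

lemma upper_semicontinuous_on_subset:
  assumes "upper_semicontinuous_on M f" "N \<subseteq> M"
  shows "upper_semicontinuous_on N f"
  unfolding upper_semicontinuous_on_def
proof (intro ballI allI impI)
  fix z c assume "z \<in> N" "f z < c"
  then have "\<forall>\<^sub>F w in at z within M. f w < c"
    using assms unfolding upper_semicontinuous_on_def by blast
  then show "\<forall>\<^sub>F w in at z within N. f w < c"
    using at_le[OF assms(2)] by (rule filter_leD[rotated])
qed

lemma continuous_on_imp_upper_semicontinuous_on:
  fixes f :: "complex \<Rightarrow> real"
  assumes "continuous_on M f"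
  shows "upper_semicontinuous_on M f"
  using assms order_tendstoD(2) unfolding upper_semicontinuous_on_def continuous_on_def by blast

lemma upper_semicontinuous_on_add:
  assumes "upper_semicontinuous_on M f" "upper_semicontinuous_on M g"
  shows "upper_semicontinuous_on M (\<lambda>z. f z + g z)"
  unfolding upper_semicontinuous_on_def
proof (intro ballI allI impI)
  fix z c assume z: "z \<in> M" and c: "f z + g z < c"
  define d where "d = (c - f z - g z) / 2"
  have "d > 0" using c by (simp add: d_def)
  then have "\<forall>\<^sub>F w in at z within M. f w < f z + d" "\<forall>\<^sub>F w in at z within M. g w < g z + d"
    using assms z unfolding upper_semicontinuous_on_def by auto
  then show "\<forall>\<^sub>F w in at z within M. f w + g w < c"
    by eventually_elim (simp add: d_def field_simps)
qed

lemma upper_semicontinuous_on_compose: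
  assumes f: "upper_semicontinuous_on M f" and g: "continuous_on N g" "g ` N \<subseteq> M"
  shows "upper_semicontinuous_on N (\<lambda>z. f (g z))"
  unfolding upper_semicontinuous_on_def
proof (intro ballI allI impI)
  fix z c assume z: "z \<in> N" and c: "f (g z) < c"
  then have "\<forall>\<^sub>F w in at (g z) within M. f w < c"
    using f g unfolding upper_semicontinuous_on_def by blast
  \<comment> \<open>The punctured filter says nothing at \<open>g z\<close> itself, a value
    \<open>g\<close> may take at points other than \<open>z\<close>; \<open>c\<close> supplies the
    bound there.\<close>
  then obtain S where S: "open S" "g z \<in> S" "\<And>w. w \<in> S \<Longrightarrow> w \<in> M \<Longrightarrow> f w < c"
    using c unfolding eventually_at_topological by metis
  then have "\<forall>\<^sub>F w in at z within N. g w \<in> S"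
    using g(1) z topological_tendstoD unfolding continuous_on_def by blast
  moreover have "\<forall>\<^sub>F w in at z within N. w \<in> N"
    by (simp add: eventually_at_filter)
  ultimately show "\<forall>\<^sub>F w in at z within N. f (g w) < c"
    by eventually_elim (use S(3) g(2) in blast)
qed

text \<open>If no point were a maximum, every \<open>z\<close> would have a neighbourhood on which
  \<open>f\<close> stays below some \<open>f (w z)\<close>. Finitely many of these cover
  \<open>K\<close>, and the point with the largest of their bounds lies in one of them, so its value
  is below another bound.\<close>

lemma upper_semicontinuous_on_attains_sup:
  assumes usc: "upper_semicontinuous_on K f" and K: "compact K" "K \<noteq> {}"
  shows "\<exists>a\<in>K. \<forall>z\<in>K. f z \<le> f a"
proof (rule ccontr)
  assume "\<not> ?thesis"
  then have ex: "\<exists>w\<in>K. f z < f w" if "z \<in> K" for z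
    using that by (meson linorder_not_le)
  have "\<exists>w S. w \<in> K \<and> open S \<and> z \<in> S \<and> (\<forall>x\<in>S \<inter> K. f x < f w)" if z: "z \<in> K" for z
  proof -
    obtain w where w: "w \<in> K" "f z < f w" using ex z by blast
    then have "\<forall>\<^sub>F x in at z within K. f x < f w"
      using usc z unfolding upper_semicontinuous_on_def by blast
    then show ?thesis
      using w unfolding eventually_at_topological by (metis IntD1 IntD2)
  qed
  then obtain w S where wS: "\<And>z. z \<in> K \<Longrightarrow> w z \<in> K" "\<And>z. z \<in> K \<Longrightarrow> open (S z)"
      "\<And>z. z \<in> K \<Longrightarrow> z \<in> S z" "\<And>z x. z \<in> K \<Longrightarrow> x \<in> S z \<Longrightarrow> x \<in> K \<Longrightarrow> f x < f (w z)"
    by (metis IntI)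
  have "K \<subseteq> (\<Union>z\<in>K. S z)" using wS(3) by blast
  then obtain Z where Z: "Z \<subseteq> K" "finite Z" "K \<subseteq> (\<Union>z\<in>Z. S z)"
    using compactE_image[OF K(1), of K S] wS(2) by metis
  have "Z \<noteq> {}" using Z K by auto
  then have "Max ((\<lambda>y. f (w y)) ` Z) \<in> (\<lambda>y. f (w y)) ` Z" using Z(2) by simp
  then obtain z where "z \<in> Z" "f (w z) = Max ((\<lambda>y. f (w y)) ` Z)" by auto
  then have z: "z \<in> Z" "\<And>y. y \<in> Z \<Longrightarrow> f (w y) \<le> f (w z)" using Z(2) by simp_all
  then obtain y where y: "y \<in> Z" "w z \<in> S y" using Z wS(1) by blast
  then have "f (w z) < f (w y)" using wS z Z by blast
  then show False using z(2)[OF y(1)] by simp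
qed

section \<open>Means over circles\<close>

lemma circle_mean_holomorphic:
  assumes f: "f holomorphic_on M" and sub: "\<And>\<zeta>. \<zeta> \<in> cball 0 1 \<Longrightarrow> a + \<zeta> * b \<in> M"
  shows "((\<lambda>\<theta>. f (a + cis \<theta> * b)) has_integral 2 * of_real pi * f a) {0..2 * pi}"
proof -
  have "(\<lambda>\<zeta>. a + \<zeta> * b) ` cball 0 1 \<subseteq> M" using sub by blast
  then have "(\<lambda>\<zeta>. f (a + \<zeta> * b)) holomorphic_on cball 0 1"
    by (intro holomorphic_on_compose_gen[OF _ f, unfolded o_def] holomorphic_intros)
  then have "((\<lambda>u. f (a + u * b) / (u - 0)) has_contour_integral (2 * of_real pi * \<i> * f (a + 0 * b)))
      (circlepath 0 1)"
    by (intro Cauchy_integral_circlepath)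
      (auto intro: holomorphic_on_imp_continuous_on holomorphic_on_subset ball_subset_cball)
  then have "((\<lambda>\<theta>. \<i> * f (a + cis \<theta> * b)) has_integral 2 * of_real pi * \<i> * f a) {0..2 * pi}"
    unfolding circlepath_def by (subst (asm) has_contour_integral_part_circlepath_iff)
      (simp_all add: field_simps)
  from has_integral_mult_right[OF this, of "- \<i>"] show ?thesis
    by (simp add: algebra_simps)
qed

text \<open>The circle mean of \<open>C + Re F\<close> is its value at the centre, so integrating
  the bound on the circle carries it to the centre. This is how the sub-mean-value inequality of a
  competitor is used.\<close>

lemma plurisubharmonic_on_le_Re_holomorphic:
  assumes v: "plurisubharmonic_on M v" and sub: "cball a \<rho> \<subseteq> M" and "\<rho> \<ge> 0"
    and F: "F holomorphic_on cball a \<rho>"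
    and le: "\<And>z. z \<in> sphere a \<rho> \<Longrightarrow> v z \<le> C + Re (F z)"
  shows "v a \<le> C + Re (F a)"
proof -
  have disc: "a + \<zeta> * of_real \<rho> \<in> cball a \<rho>" if "\<zeta> \<in> cball 0 1" for \<zeta>
    using that \<open>\<rho> \<ge> 0\<close> by (simp add: dist_norm norm_mult mult_left_le_one_le)
  then have int: "(\<lambda>\<theta>. v (a + cis \<theta> * \<rho>)) absolutely_integrable_on {0..2 * pi}"
    and mean: "v a \<le> 1 / (2 * pi) * integral {0..2 * pi} (\<lambda>\<theta>. v (a + cis \<theta> * \<rho>))"
    using v sub unfolding plurisubharmonic_on_def by blast+
  have "((\<lambda>\<theta>. Re (F (a + cis \<theta> * \<rho>))) has_integral 2 * pi * Re (F a)) {0..2 * pi}"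
    using has_integral_Re[OF circle_mean_holomorphic[OF F disc]] by simp
  moreover have "((\<lambda>\<theta>. C) has_integral 2 * pi * C) {0..2 * pi}"
    using has_integral_const_real[of C 0 "2 * pi"] by simp
  ultimately have RF: "((\<lambda>\<theta>. C + Re (F (a + cis \<theta> * \<rho>))) has_integral 2 * pi * (C + Re (F a))) {0..2 * pi}"
    by (simp add: has_integral_add distrib_left)
  have "integral {0..2 * pi} (\<lambda>\<theta>. v (a + cis \<theta> * \<rho>)) \<le> 2 * pi * (C + Re (F a))"
    using set_lebesgue_integral_eq_integral(1)[OF int]
    by (intro has_integral_le[OF integrable_integral RF] le)
      (use \<open>\<rho> \<ge> 0\<close> in \<open>auto simp: dist_norm norm_mult\<close>)
  then show ?thesis
    using order_trans[OF mean, of "C + Re (F a)"] by (simp add: field_simps)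
qed

section \<open>The Cayley map and the imaginary part of \<open>artanh\<close>\<close>

lemma Re_cayley: "Re ((1 + z) / (1 - z)) = (1 - (cmod z)\<^sup>2) / (cmod (1 - z))\<^sup>2"
  by (simp add: Re_divide cmod_power2) (simp add: power2_eq_square algebra_simps)

lemma Im_cayley: "Im ((1 + z) / (1 - z)) = 2 * Im z / (cmod (1 - z))\<^sup>2"
  by (simp add: Im_divide cmod_power2) (simp add: power2_eq_square algebra_simps)

lemma Im_artanh: "Im (artanh z) = Im (Ln ((1 + z) / (1 - z))) / 2"
  by (simp add: artanh_def)

text \<open>The Cayley image of such a point has nonnegative real part and is not 0, so it misses
  the cut of \<open>Ln\<close>. The boundary circle is included for the semicontinuity on the closed
  disc and for the limit at \<open>\<i>\<close>.\<close>

lemma has_field_derivative_artanh_complex: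
  fixes z :: complex
  assumes "cmod z \<le> 1" "z \<noteq> 1" "z \<noteq> -1"
  shows "(artanh has_field_derivative 1 / (1 - z\<^sup>2)) (at z)"
proof -
  have nz: "1 - z \<noteq> 0" "1 + z \<noteq> 0" using assms by (auto simp: add_eq_0_iff)
  have "Re ((1 + z) / (1 - z)) \<ge> 0"
    using assms by (simp add: Re_cayley power_le_one)
  moreover have "(1 + z) / (1 - z) \<noteq> 0" using nz by simp
  ultimately have np: "(1 + z) / (1 - z) \<notin> \<real>\<^sub>\<le>\<^sub>0"
    by (auto simp: complex_nonpos_Reals_iff complex_eq_iff)
  have "((\<lambda>z. (1 + z) / (1 - z)) has_field_derivative 2 / (1 - z)\<^sup>2) (at z)"
    using nz by (auto intro!: derivative_eq_intros simp: power2_eq_square)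
  then have "((\<lambda>z. Ln ((1 + z) / (1 - z)) / 2) has_field_derivative
      inverse ((1 + z) / (1 - z)) * (2 / (1 - z)\<^sup>2) / 2) (at z)"
    by (intro DERIV_cdivide DERIV_chain2[where f = Ln] has_field_derivative_Ln[OF np])
  also have "inverse ((1 + z) / (1 - z)) * (2 / (1 - z)\<^sup>2) / 2 = 1 / ((1 + z) * (1 - z))"
  proof -
    have "inverse (p / d) * (2 / d\<^sup>2) / 2 = 1 / (p * d)" for p d :: complex
      by (simp add: power2_eq_square)
    then show ?thesis .
  qed
  also have "(1 + z) * (1 - z) = 1 - z\<^sup>2" by (simp add: power2_eq_square algebra_simps)
  finally show ?thesis by (simp add: artanh_def[abs_def])
qed

lemma isCont_artanh_complex:
  fixes z :: complex
  assumes "cmod z \<le> 1" "z \<noteq> 1" "z \<noteq> -1"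
  shows "isCont artanh z"
  using has_field_derivative_artanh_complex[OF assms] DERIV_isCont by blast

lemma holomorphic_on_artanh_disc: "artanh holomorphic_on ball (0::complex) 1"
proof (rule holomorphic_on_open[THEN iffD2, rule_format])
  fix z :: complex assume "z \<in> ball 0 1"
  then have "cmod z \<le> 1" "z \<noteq> 1" "z \<noteq> -1" by auto
  then show "\<exists>f'. (artanh has_field_derivative f') (at z)"
    using has_field_derivative_artanh_complex by blast
qed simp

lemma abs_Im_artanh_less:
  assumes "cmod z < 1"
  shows "\<bar>Im (artanh z)\<bar> < pi / 4"
proof -
  have "z \<noteq> 1" using assms by auto
  moreover have "(cmod z)\<^sup>2 < 1" using assms by (simp add: abs_square_less_1)
  ultimately have "Re ((1 + z) / (1 - z)) > 0" by (simp add: Re_cayley)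
  from Re_Ln_pos_lt_imp[OF this] show ?thesis by (simp add: Im_artanh)
qed

text \<open>The Cayley image is purely imaginary, and nonzero because \<open>z\<close> is not -1;
  its argument is therefore \<pi>/2 up to sign.\<close>

lemma abs_Im_artanh_unit_circle:
  assumes "cmod z = 1" "Im z \<noteq> 0"
  shows "\<bar>Im (artanh z)\<bar> = pi / 4"
proof -
  let ?w = "(1 + z) / (1 - z)"
  have "z \<noteq> 1" using assms by auto
  then have "Re ?w = 0" "Im ?w \<noteq> 0" using assms by (auto simp: Re_cayley Im_cayley)
  moreover from this have "?w \<noteq> 0" by (metis zero_complex.simps(2))
  ultimately have "Im (Ln ?w) = pi / 2 \<or> Im (Ln ?w) = - (pi / 2)"
    using Im_Ln_eq_pi_half[of ?w] by linarith
  then have "\<bar>Im (Ln ?w)\<bar> = pi / 2" using pi_gt_zero by linarith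
  then show ?thesis by (simp add: Im_artanh)
qed

lemma Im_artanh_pos:
  assumes "Im z > 0"
  shows "Im (artanh z) > 0"
proof -
  have "z \<noteq> 1" using assms by auto
  then have "Im ((1 + z) / (1 - z)) > 0" using assms by (simp add: Im_cayley)
  from Im_Ln_pos_lt_imp[OF this] show ?thesis by (simp add: Im_artanh)
qed

lemma Im_artanh_neg:
  assumes "Im z < 0"
  shows "Im (artanh z) < 0"
proof -
  have "z \<noteq> 1" using assms by auto
  then have w: "Im ((1 + z) / (1 - z)) < 0" using assms by (simp add: Im_cayley divide_less_0_iff)
  then have "(1 + z) / (1 - z) \<noteq> 0" by (metis less_irrefl zero_complex.simps(2))
  \<comment> \<open>A nonnegative argument, being at most \<pi>, would force a nonnegative imaginary
    part of the Cayley image.\<close>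
  then have "\<not> 0 \<le> Im (Ln ((1 + z) / (1 - z)))"
    using w Im_Ln_pos_le[of "(1 + z) / (1 - z)"] Im_Ln_le_pi[of "(1 + z) / (1 - z)"] by linarith
  then show ?thesis by (simp add: Im_artanh)
qed

lemma Im_artanh_real:
  assumes "Im z = 0" "cmod z < 1"
  shows "Im (artanh z) = 0"
proof -
  have "\<bar>Re z\<bar> < 1" using assms abs_Re_le_cmod[of z] by linarith
  then have "(1 + Re z) / (1 - Re z) > 0" by simp
  moreover have "z = of_real (Re z)" using assms(1) by (simp add: complex_eq_iff)
  then have "(1 + z) / (1 - z) = of_real ((1 + Re z) / (1 - Re z))"
    by (metis of_real_1 of_real_add of_real_diff of_real_divide)
  ultimately show ?thesis by (simp only: Im_artanh Im_Ln_of_real)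
qed

section \<open>The candidate belongs to the class\<close>

lemma abs_Im_artanh_plurisubharmonic: "plurisubharmonic_on unit_disc (\<lambda>z. \<bar>Im (artanh z)\<bar>)"
proof -
  have cont: "continuous_on unit_disc (\<lambda>z. \<bar>Im (artanh z)\<bar>)"
    by (intro continuous_intros holomorphic_on_imp_continuous_on holomorphic_on_artanh_disc)
  show ?thesis
    unfolding plurisubharmonic_on_def
  proof (intro conjI allI impI)
    show "upper_semicontinuous_on unit_disc (\<lambda>z. \<bar>Im (artanh z)\<bar>)"
      by (rule continuous_on_imp_upper_semicontinuous_on[OF cont])
  next
    fix a b :: complex assume ab: "\<forall>\<zeta>\<in>cball 0 1. a + \<zeta> * b \<in> unit_disc"
    have "continuous_on {0..2 * pi} (\<lambda>\<theta>. \<bar>Im (artanh (a + cis \<theta> * b))\<bar>)"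
      by (rule continuous_on_compose2[OF cont]) (use ab in \<open>auto intro!: continuous_intros\<close>)
    then show int: "(\<lambda>\<theta>. \<bar>Im (artanh (a + cis \<theta> * b))\<bar>) absolutely_integrable_on {0..2 * pi}"
      by (simp add: absolutely_integrable_continuous_real)
    \<comment> \<open>\<open>Im artanh\<close> is harmonic, so its circle mean is exact; the modulus
      of an integral is at most the integral of the modulus.\<close>
    have "((\<lambda>\<theta>. artanh (a + cis \<theta> * b)) has_integral 2 * of_real pi * artanh a) {0..2 * pi}"
      using ab by (intro circle_mean_holomorphic[OF holomorphic_on_artanh_disc]) auto
    from has_integral_Im[OF this]
    have I: "((\<lambda>\<theta>. Im (artanh (a + cis \<theta> * b))) has_integral 2 * pi * Im (artanh a)) {0..2 * pi}"
      by simp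
    have "norm (integral {0..2 * pi} (\<lambda>\<theta>. Im (artanh (a + cis \<theta> * b))))
       \<le> integral {0..2 * pi} (\<lambda>\<theta>. \<bar>Im (artanh (a + cis \<theta> * b))\<bar>)"
      using I set_lebesgue_integral_eq_integral(1)[OF int]
      by (intro integral_norm_bound_integral) (auto simp: has_integral_integrable)
    then have "2 * pi * \<bar>Im (artanh a)\<bar> \<le> integral {0..2 * pi} (\<lambda>\<theta>. \<bar>Im (artanh (a + cis \<theta> * b))\<bar>)"
      using I by (simp add: integral_unique abs_mult)
    then show "\<bar>Im (artanh a)\<bar> \<le> 1 / (2 * pi) * integral {0..2 * pi} (\<lambda>\<theta>. \<bar>Im (artanh (a + cis \<theta> * b))\<bar>)"
      by (simp add: field_simps)
  qed
qed

lemma mem_real_interval_iff: "z \<in> real_interval \<longleftrightarrow> Im z = 0 \<and> cmod z < 1"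
proof
  assume "Im z = 0 \<and> cmod z < 1"
  then have "z = of_real (Re z)" "\<bar>Re z\<bar> < 1"
    using abs_Re_le_cmod[of z] by (auto simp: complex_eq_iff)
  then show "z \<in> real_interval" by (intro image_eqI[of _ _ "Re z"]) auto
qed auto

lemma abs_Im_artanh_in_U_class: "(\<lambda>z. \<bar>Im (artanh z)\<bar>) \<in> U_class real_interval unit_disc"
  unfolding U_class_def
  using abs_Im_artanh_plurisubharmonic abs_Im_artanh_less Im_artanh_real mem_real_interval_iff
  by auto

section \<open>Comparison of a competitor with the dilates\<close>

text \<open>The values of \<open>artanh\<close> at \<open>1\<close> and \<open>-1\<close> are junk, since \<open>Ln 0\<close> is unspecified.
  Setting the function to \<open>0\<close> there makes it lower semicontinuous on the closed disc.\<close>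

definition abs_Im_artanh_closed :: "complex \<Rightarrow> real" where
  "abs_Im_artanh_closed z = (if Im z = 0 then 0 else \<bar>Im (artanh z)\<bar>)"

lemma abs_Im_artanh_closed_eq: "cmod z < 1 \<Longrightarrow> abs_Im_artanh_closed z = \<bar>Im (artanh z)\<bar>"
  by (simp add: abs_Im_artanh_closed_def Im_artanh_real)

text \<open>At real points, 1 and -1 among them, the nonnegative function takes its least value 0;
  at the other points of the closed disc \<open>artanh\<close> is continuous. The sign is reversed
  so that the function can be added to a competitor.\<close>

lemma upper_semicontinuous_on_neg_abs_Im_artanh_closed:
  "upper_semicontinuous_on (cball 0 1) (\<lambda>z. - abs_Im_artanh_closed z)"
  unfolding upper_semicontinuous_on_def
proof (intro ballI allI impI)
  fix z :: complex and c :: real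
  assume z: "z \<in> cball 0 1" and c: "- abs_Im_artanh_closed z < c"
  show "\<forall>\<^sub>F w in at z within cball 0 1. - abs_Im_artanh_closed w < c"
  proof (cases "Im z = 0")
    case True
    then have "c > 0" using c by (simp add: abs_Im_artanh_closed_def)
    then have "- abs_Im_artanh_closed w < c" for w
      by (auto simp: abs_Im_artanh_closed_def intro: le_less_trans[of _ 0])
    then show ?thesis by simp
  next
    case False
    then have "isCont artanh z" using z by (intro isCont_artanh_complex) auto
    then have "isCont (\<lambda>z. - \<bar>Im (artanh z)\<bar>) z"
      unfolding isCont_def by (intro tendsto_intros)
    moreover have "- \<bar>Im (artanh z)\<bar> < c" using c False by (simp add: abs_Im_artanh_closed_def)
    ultimately have "\<forall>\<^sub>F w in at z. - \<bar>Im (artanh w)\<bar> < c"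
      unfolding isCont_def by (rule order_tendstoD(2))
    moreover have "isCont Im z" by (rule isCont_Im) simp
    then have "\<forall>\<^sub>F w in at z. Im w \<noteq> 0"
      using False unfolding isCont_def by (rule tendsto_imp_eventually_ne)
    ultimately have "\<forall>\<^sub>F w in at z. - abs_Im_artanh_closed w < c"
      by eventually_elim (simp add: abs_Im_artanh_closed_def)
    then show ?thesis using at_le[OF subset_UNIV] by (rule filter_leD[rotated])
  qed
qed

lemma U_class_le_abs_Im_artanh_dilated:
  assumes v: "v \<in> U_class real_interval unit_disc" and r: "0 < r" "r < 1" and z: "cmod z \<le> r"
  shows "v z \<le> abs_Im_artanh_closed (z / of_real r)"
proof (rule field_le_epsilon)
  fix e :: real assume "e > 0"
  have psh: "plurisubharmonic_on unit_disc v" and v_less: "\<And>w. w \<in> unit_disc \<Longrightarrow> v w < pi / 4"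
    and v_real: "\<And>w. w \<in> real_interval \<Longrightarrow> v w = 0"
    using v unfolding U_class_def by force+
  define K where "K = cball (0::complex) r"
  \<comment> \<open>The quadratic term makes \<open>\<phi>\<close> strictly subharmonic off the real axis, so that a maximum there
    contradicts the mean value inequality directly, with no equality case to discuss.\<close>
  define \<phi> where "\<phi> w = v w + (- abs_Im_artanh_closed (w / of_real r)) + e * (cmod w)\<^sup>2" for w
  have "K \<subseteq> unit_disc" using r by (auto simp: K_def)
  moreover have "(\<lambda>w. w / of_real r) ` K \<subseteq> cball 0 1"
    using r by (auto simp: K_def norm_divide)
  then have "upper_semicontinuous_on K (\<lambda>w. - abs_Im_artanh_closed (w / of_real r))"
    using r by (intro upper_semicontinuous_on_compose[OF upper_semicontinuous_on_neg_abs_Im_artanh_closed]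
      continuous_intros) auto
  moreover have "upper_semicontinuous_on K (\<lambda>w. e * (cmod w)\<^sup>2)"
    by (intro continuous_on_imp_upper_semicontinuous_on continuous_intros)
  ultimately have usc: "upper_semicontinuous_on K \<phi>"
    using psh unfolding \<phi>_def plurisubharmonic_on_def
    by (intro upper_semicontinuous_on_add) (blast intro: upper_semicontinuous_on_subset)+
  have "compact K" "K \<noteq> {}" using r by (auto simp: K_def)
  then obtain a where a: "a \<in> K" "\<And>w. w \<in> K \<Longrightarrow> \<phi> w \<le> \<phi> a"
    using upper_semicontinuous_on_attains_sup[OF usc] by blast
  \<comment> \<open>At any other maximum point the mean value inequality on a small circle is
    violated.\<close>
  have not_interior: "Im a = 0 \<or> cmod a = r"
  proof (rule ccontr)
    assume "\<not> (Im a = 0 \<or> cmod a = r)"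
    then have "Im a \<noteq> 0" and "cmod a < r" using a(1) by (auto simp: K_def)
    \<comment> \<open>The radius keeps the closed disc around \<open>a\<close> inside the disc of
      radius \<open>r\<close> and on one side of the real axis.\<close>
    define \<rho> where "\<rho> = min (r - cmod a) \<bar>Im a\<bar> / 2"
    define s where "s = sgn (Im a)"
    \<comment> \<open>On that disc the first term has the dilate as its real part, \<open>s\<close>
      removing the modulus. The second term cancels the nonconstant harmonic part of
      \<open>e * (cmod w)\<^sup>2\<close> in its expansion about \<open>a\<close>.\<close>
    define F where "F w = - \<i> * of_real s * artanh (w / of_real r) - 2 * of_real e * cnj a * w" for w
    have \<rho>: "\<rho> > 0" "\<rho> < r - cmod a" "\<rho> < \<bar>Im a\<bar>"
      using \<open>Im a \<noteq> 0\<close> \<open>cmod a < r\<close> by (auto simp: \<rho>_def min_def)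
    have in_disc: "cmod w < r" and ReF: "Re (F w) = abs_Im_artanh_closed (w / of_real r) - 2 * e * Re (cnj a * w)"
      if w: "w \<in> cball a \<rho>" for w
    proof -
      show "cmod w < r"
        using w \<rho>(2) norm_triangle_sub[of w a] by (auto simp: dist_norm norm_minus_commute)
      have "\<bar>Im w - Im a\<bar> < \<bar>Im a\<bar>"
        using w \<rho>(3) abs_Im_le_cmod[of "w - a"] by (auto simp: dist_norm norm_minus_commute)
      then have "s * Im (artanh (w / of_real r)) = abs_Im_artanh_closed (w / of_real r)"
      proof (cases "Im a > 0")
        case True
        then have "Im (w / of_real r) > 0" using \<open>\<bar>Im w - Im a\<bar> < \<bar>Im a\<bar>\<close> r by simp
        with Im_artanh_pos[OF this] True show ?thesis
          by (auto simp: s_def abs_Im_artanh_closed_def)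
      next
        case False
        then have "Im (w / of_real r) < 0"
          using \<open>\<bar>Im w - Im a\<bar> < \<bar>Im a\<bar>\<close> r by (simp add: divide_less_0_iff)
        with Im_artanh_neg[OF this] False \<open>Im a \<noteq> 0\<close> show ?thesis
          by (auto simp: s_def abs_Im_artanh_closed_def)
      qed
      then show "Re (F w) = abs_Im_artanh_closed (w / of_real r) - 2 * e * Re (cnj a * w)"
        by (simp add: F_def algebra_simps)
    qed
    have sub: "cball a \<rho> \<subseteq> unit_disc" using in_disc r by fastforce
    have "(\<lambda>w. artanh (w / of_real r)) holomorphic_on cball a \<rho>"
      using in_disc r
      by (intro holomorphic_on_compose_gen[OF _ holomorphic_on_artanh_disc, unfolded o_def])
        (auto intro!: holomorphic_intros simp: norm_divide)
    then have holF: "F holomorphic_on cball a \<rho>"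
      unfolding F_def by (intro holomorphic_intros)
    \<comment> \<open>Expanding about \<open>a\<close> leaves a harmonic function and the square of
      the distance to \<open>a\<close>, which is constant on the circle.\<close>
    have norm_sq: "(cmod w)\<^sup>2 = (cmod (w - a))\<^sup>2 + 2 * Re (cnj a * w) - (cmod a)\<^sup>2" for w
      by (simp only: cmod_power2) (simp add: power2_eq_square algebra_simps)
    \<comment> \<open>Maximality of \<open>\<phi>\<close> at \<open>a\<close>, rewritten; the strict
      gain \<open>e * \<rho>\<^sup>2\<close> is what the quadratic term leaves on the circle. At the
      centre this bound reads \<open>v a \<le> v a - e * \<rho>\<^sup>2\<close>.\<close>
    have "v w \<le> (v a - Re (F a) - e * \<rho>\<^sup>2) + Re (F w)" if w: "w \<in> sphere a \<rho>" for w
    proof -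
      have "w \<in> cball a \<rho>" "w \<in> K" using w in_disc[of w] by (auto simp: K_def)
      then have "\<phi> w \<le> \<phi> a" using a(2) by blast
      moreover have "cmod (w - a) = \<rho>" using w by (simp add: dist_norm norm_minus_commute)
      then have "\<phi> w = v w - Re (F w) + e * (\<rho>\<^sup>2 - (cmod a)\<^sup>2)"
        unfolding \<phi>_def norm_sq[of w] ReF[OF \<open>w \<in> cball a \<rho>\<close>] by (simp add: algebra_simps)
      moreover have "\<phi> a = v a - Re (F a) - e * (cmod a)\<^sup>2"
        using ReF[of a] \<rho>(1) norm_sq[of a] by (simp add: \<phi>_def algebra_simps)
      ultimately show ?thesis by (simp add: algebra_simps)
    qed
    from plurisubharmonic_on_le_Re_holomorphic[OF psh sub _ holF this] \<rho>(1)
    have "e * \<rho>\<^sup>2 \<le> 0" by simp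
    then show False using \<open>e > 0\<close> \<rho>(1) by (simp add: mult_le_0_iff)
  qed
  \<comment> \<open>On the real axis, endpoints included, both sides vanish, since
    \<open>r < 1\<close> keeps \<open>a\<close> in the unit disc. Elsewhere on the circle the dilate
    is \<pi>/4, which \<open>v\<close> stays below.\<close>
  have "v a \<le> abs_Im_artanh_closed (a / of_real r)"
  proof (cases "Im a = 0")
    case True
    then have "v a = 0" using a(1) r by (intro v_real) (auto simp: mem_real_interval_iff K_def)
    then show ?thesis by (simp add: abs_Im_artanh_closed_def)
  next
    case False
    then have "abs_Im_artanh_closed (a / of_real r) = pi / 4"
      using not_interior r by (simp add: abs_Im_artanh_closed_def abs_Im_artanh_unit_circle norm_divide)
    then show ?thesis using v_less[of a] a(1) r by (simp add: K_def)
  qed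
  moreover have "e * (cmod a)\<^sup>2 \<le> e"
    using a(1) r \<open>e > 0\<close> by (simp add: K_def power_le_one)
  ultimately have "\<phi> a \<le> e" by (simp add: \<phi>_def)
  moreover have "\<phi> z \<le> \<phi> a" using z by (intro a(2)) (simp add: K_def)
  moreover have "e * (cmod z)\<^sup>2 \<ge> 0" using \<open>e > 0\<close> by simp
  ultimately show "v z \<le> abs_Im_artanh_closed (z / of_real r) + e"
    by (simp add: \<phi>_def)
qed

section \<open>Maximality of the candidate\<close>

lemma U_class_le_abs_Im_artanh:
  assumes v: "v \<in> U_class real_interval unit_disc" and z: "z \<in> unit_disc"
  shows "v z \<le> \<bar>Im (artanh z)\<bar>"
proof (rule tendsto_lowerbound)
  have "isCont artanh z" using z by (intro isCont_artanh_complex) auto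
  moreover have "((\<lambda>r. z / of_real r) \<longlongrightarrow> z / of_real 1) (at_left 1)"
    by (intro tendsto_intros) auto
  ultimately have "((\<lambda>r. artanh (z / of_real r)) \<longlongrightarrow> artanh z) (at_left 1)"
    by (intro isCont_tendsto_compose[of z artanh]) auto
  then show "((\<lambda>r. \<bar>Im (artanh (z / of_real r))\<bar>) \<longlongrightarrow> \<bar>Im (artanh z)\<bar>) (at_left 1)"
    by (intro tendsto_intros)
  \<comment> \<open>For these \<open>r\<close> the point \<open>z / r\<close> is in the open disc,
    where the modified function agrees with the candidate.\<close>
  have "\<forall>\<^sub>F r in at_left 1. r \<in> {cmod z<..<1}"
    using z by (intro eventually_at_left_real) auto
  then show "\<forall>\<^sub>F r in at_left 1. v z \<le> \<bar>Im (artanh (z / of_real r))\<bar>"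
  proof eventually_elim
    fix r assume "r \<in> {cmod z<..<1}"
    then have r: "0 < r" "r < 1" "cmod z < r" by (auto intro: le_less_trans[OF norm_ge_zero])
    then have "v z \<le> abs_Im_artanh_closed (z / of_real r)"
      by (intro U_class_le_abs_Im_artanh_dilated[OF v]) auto
    then show "v z \<le> \<bar>Im (artanh (z / of_real r))\<bar>"
      using r by (simp add: abs_Im_artanh_closed_eq norm_divide)
  qed
qed simp

lemma SUP_abs_Im_artanh: "(SUP z\<in>unit_disc. \<bar>Im (artanh z)\<bar>) = pi / 4"
proof (rule antisym)
  show "(SUP z\<in>unit_disc. \<bar>Im (artanh z)\<bar>) \<le> pi / 4"
    by (rule cSUP_least) (use abs_Im_artanh_less in \<open>auto intro: less_imp_le\<close>)
  show "pi / 4 \<le> (SUP z\<in>unit_disc. \<bar>Im (artanh z)\<bar>)"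
  proof (rule tendsto_upperbound)
    \<comment> \<open>The boundary value \<pi>/4 is approached along the imaginary axis, at whose
      endpoint \<open>\<i>\<close> the function \<open>artanh\<close> is continuous.\<close>
    have "isCont artanh \<i>" by (intro isCont_artanh_complex) (auto simp: complex_eq_iff)
    moreover have "((\<lambda>t. of_real t * \<i>) \<longlongrightarrow> of_real 1 * \<i>) (at_left 1)"
      by (intro tendsto_intros)
    ultimately have "((\<lambda>t. artanh (of_real t * \<i>)) \<longlongrightarrow> artanh \<i>) (at_left 1)"
      by (intro isCont_tendsto_compose[of \<i> artanh]) auto
    then have "((\<lambda>t. \<bar>Im (artanh (of_real t * \<i>))\<bar>) \<longlongrightarrow> \<bar>Im (artanh \<i>)\<bar>) (at_left 1)"
      by (intro tendsto_intros)
    then show "((\<lambda>t. \<bar>Im (artanh (of_real t * \<i>))\<bar>) \<longlongrightarrow> pi / 4) (at_left 1)"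
      by (simp add: abs_Im_artanh_unit_circle)
    have bdd: "bdd_above ((\<lambda>z. \<bar>Im (artanh z)\<bar>) ` unit_disc)"
      using abs_Im_artanh_less by (intro bdd_aboveI2[of _ _ "pi / 4"]) (auto intro: less_imp_le)
    have "\<forall>\<^sub>F t in at_left 1. t \<in> {0<..<1::real}"
      by (intro eventually_at_left_real) auto
    then show "\<forall>\<^sub>F t in at_left 1. \<bar>Im (artanh (of_real t * \<i>))\<bar> \<le> (SUP z\<in>unit_disc. \<bar>Im (artanh z)\<bar>)"
      by eventually_elim (intro cSUP_upper[OF _ bdd], auto simp: norm_mult)
  qed simp
qed

lemma abs_Im_artanh_maximal: "maximal_in_U real_interval unit_disc (\<lambda>z. \<bar>Im (artanh z)\<bar>)"
  unfolding maximal_in_U_def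
proof (intro conjI ballI)
  fix z assume "z \<in> unit_disc - real_interval"
  then have "Im z \<noteq> 0" by (auto simp: mem_real_interval_iff)
  then show "0 < \<bar>Im (artanh z)\<bar>"
    using Im_artanh_pos[of z] Im_artanh_neg[of z] by linarith
qed (use abs_Im_artanh_in_U_class U_class_le_abs_Im_artanh SUP_abs_Im_artanh in auto)

section \<open>The metric computed from the candidate\<close>

text \<open>The upper limit is a genuine limit. As \<open>Im artanh\<close> vanishes at
  \<open>x\<close>, its quotient by \<open>t\<close> along the curve is a difference quotient, and
  the factor \<open>\<i>\<close> in the velocity makes the derivative of \<open>artanh\<close> along
  the curve purely imaginary.\<close>

lemma Limsup_abs_Im_artanh_curve:
  fixes x \<xi> :: real
  assumes x: "\<bar>x\<bar> < 1" and \<gamma>: "\<gamma> \<in> curves M (of_real x) (\<i> * of_real \<xi>)"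
  shows "Limsup (at_right 0) (\<lambda>t. ereal (\<bar>Im (artanh (\<gamma> t))\<bar> / t)) = ereal (\<bar>\<xi>\<bar> / (1 - x\<^sup>2))"
proof -
  have \<gamma>0: "\<gamma> 0 = of_real x" and d\<gamma>: "(\<gamma> has_vector_derivative \<i> * of_real \<xi>) (at 0)"
    using \<gamma> by (auto simp: curves_def)
  have x2: "x\<^sup>2 < 1" using x by (simp add: abs_square_less_1)
  have "(artanh has_field_derivative 1 / (1 - (of_real x)\<^sup>2)) (at (\<gamma> 0))"
    unfolding \<gamma>0 using x by (intro has_field_derivative_artanh_complex) (auto simp: complex_eq_iff)
  from field_vector_diff_chain_at[OF d\<gamma> this]
  have "((\<lambda>t. artanh (\<gamma> t)) has_vector_derivative (\<i> * of_real \<xi> * (1 / (1 - (of_real x)\<^sup>2)))) (at 0)"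
    by (simp add: o_def)
  then have "((\<lambda>t. Im (artanh (\<gamma> t))) has_vector_derivative
      Im (\<i> * of_real \<xi> * (1 / (1 - (of_real x)\<^sup>2)))) (at 0)"
    by (rule bounded_linear.has_vector_derivative[OF bounded_linear_Im])
  also have "\<i> * of_real \<xi> * (1 / (1 - (of_real x)\<^sup>2)) = \<i> * of_real (\<xi> / (1 - x\<^sup>2))"
    by simp
  finally have "((\<lambda>t. Im (artanh (\<gamma> t))) has_real_derivative \<xi> / (1 - x\<^sup>2)) (at 0)"
    by (simp add: has_real_derivative_iff_has_vector_derivative)
  then have "((\<lambda>t. Im (artanh (\<gamma> t)) / t) \<longlongrightarrow> \<xi> / (1 - x\<^sup>2)) (at 0)"
    using Im_artanh_real[of "of_real x"] x by (simp add: has_field_derivative_iff \<gamma>0)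
  then have "((\<lambda>t. \<bar>Im (artanh (\<gamma> t)) / t\<bar>) \<longlongrightarrow> \<bar>\<xi> / (1 - x\<^sup>2)\<bar>) (at_right 0)"
    by (intro tendsto_rabs) (rule tendsto_within_subset[OF _ subset_UNIV])
  \<comment> \<open>The modulus passes to the numerator because \<open>t > 0\<close>.\<close>
  moreover have "\<forall>\<^sub>F t in at_right 0. \<bar>Im (artanh (\<gamma> t)) / t\<bar> = \<bar>Im (artanh (\<gamma> t))\<bar> / t"
    by (simp add: eventually_at_filter abs_divide)
  ultimately have "((\<lambda>t. \<bar>Im (artanh (\<gamma> t))\<bar> / t) \<longlongrightarrow> \<bar>\<xi> / (1 - x\<^sup>2)\<bar>) (at_right 0)"
    by (rule Lim_transform_eventually)
  also have "\<bar>\<xi> / (1 - x\<^sup>2)\<bar> = \<bar>\<xi>\<bar> / (1 - x\<^sup>2)" using x2 by (simp add: abs_divide)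
  finally have "((\<lambda>t. \<bar>Im (artanh (\<gamma> t))\<bar> / t) \<longlongrightarrow> \<bar>\<xi>\<bar> / (1 - x\<^sup>2)) (at_right 0)" .
  then show ?thesis
    by (intro lim_imp_Limsup) auto
qed

text \<open>An infimum over no curves would be \<infinity>; a short straight segment through
  \<open>p\<close> excludes this.\<close>

lemma curves_nonempty:
  assumes "open M" "p \<in> M"
  shows "curves M p \<eta> \<noteq> {}"
proof -
  let ?\<gamma> = "\<lambda>t::real. p + of_real t * \<eta>"
  have "isCont ?\<gamma> 0" by (intro continuous_intros)
  then have "\<forall>\<^sub>F t in at 0. ?\<gamma> t \<in> M"
    using assms by (intro topological_tendstoD[of ?\<gamma> p]) (auto simp: isCont_def)
  then obtain e where e: "e > 0" "\<And>t. t \<noteq> 0 \<Longrightarrow> \<bar>t\<bar> < e \<Longrightarrow> ?\<gamma> t \<in> M"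
    by (auto simp: eventually_at)
  have "?\<gamma> ` {-e<..<e} \<subseteq> M"
  proof safe
    fix t assume "t \<in> {-e<..<e}"
    then show "?\<gamma> t \<in> M" using e(2)[of t] assms(2) by (cases "t = 0") auto
  qed
  moreover have deriv: "(?\<gamma> has_vector_derivative \<eta>) (at t)" for t
    by (auto intro!: derivative_eq_intros)
  moreover have "?\<gamma> C1_differentiable_on {-e<..<e}"
    unfolding C1_differentiable_on_def using deriv by (intro exI[of _ "\<lambda>_. \<eta>"]) auto
  ultimately have "?\<gamma> \<in> curves M p \<eta>"
    using e(1) unfolding curves_def by (intro CollectI exI[of _ e]) auto
  then show ?thesis by blast
qed

lemma E_fun_mono:
  assumes "\<And>z. z \<in> M \<Longrightarrow> u z \<le> v z"
  shows "E_fun u M p \<xi> \<le> E_fun v M p \<xi>"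
  unfolding E_fun_def
proof (rule INF_mono, rule bexI)
  fix \<gamma> assume \<gamma>: "\<gamma> \<in> curves M p (\<i> * \<xi>)"
  then obtain e where e: "e > 0" "\<gamma> ` {-e<..<e} \<subseteq> M" by (auto simp: curves_def)
  have "\<forall>\<^sub>F t in at_right 0. t \<in> {0<..<e}"
    using e(1) by (rule eventually_at_right_real)
  then have "\<forall>\<^sub>F t in at_right 0. ereal (u (\<gamma> t) / t) \<le> ereal (v (\<gamma> t) / t)"
  proof eventually_elim
    fix t assume t: "t \<in> {0<..<e}"
    then have "\<gamma> t \<in> M" using e by (intro subsetD[OF e(2)]) auto
    then show "ereal (u (\<gamma> t) / t) \<le> ereal (v (\<gamma> t) / t)"
      using t assms by (simp add: divide_right_mono)
  qed
  then show "Limsup (at_right 0) (\<lambda>t. ereal (u (\<gamma> t) / t)) \<le> Limsup (at_right 0) (\<lambda>t. ereal (v (\<gamma> t) / t))"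
    by (rule Limsup_mono)
qed

lemma E_metric_eq_E_fun_maximal:
  assumes "maximal_in_U V M u"
  shows "E_metric V M p \<xi> = E_fun u M p \<xi>"
  unfolding E_metric_def
proof (rule antisym)
  show "(SUP v\<in>U_class V M. E_fun v M p \<xi>) \<le> E_fun u M p \<xi>"
    using assms by (intro SUP_least E_fun_mono) (auto simp: maximal_in_U_def)
  show "E_fun u M p \<xi> \<le> (SUP v\<in>U_class V M. E_fun v M p \<xi>)"
    using assms by (intro SUP_upper) (auto simp: maximal_in_U_def)
qed

theorem theorem3p2:
  shows "maximal_in_U real_interval unit_disc (\<lambda>z. \<bar>Im (artanh z)\<bar>) \<and>
    (\<forall>x\<in>{-1<..<1::real}. \<forall>\<xi>::real.
       E_metric real_interval unit_disc (complex_of_real x) (complex_of_real \<xi>) =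
         ereal (\<bar>\<xi>\<bar> / (1 - x\<^sup>2)))"
proof (intro conjI ballI allI)
  show "maximal_in_U real_interval unit_disc (\<lambda>z. \<bar>Im (artanh z)\<bar>)"
    by (rule abs_Im_artanh_maximal)
  fix x \<xi> :: real assume x: "x \<in> {-1<..<1}"
  then have "curves unit_disc (of_real x) (\<i> * of_real \<xi>) \<noteq> {}"
    by (intro curves_nonempty) auto
  moreover have "Limsup (at_right 0) (\<lambda>t. ereal (\<bar>Im (artanh (\<gamma> t))\<bar> / t)) = ereal (\<bar>\<xi>\<bar> / (1 - x\<^sup>2))"
    if "\<gamma> \<in> curves unit_disc (of_real x) (\<i> * of_real \<xi>)" for \<gamma>
    using Limsup_abs_Im_artanh_curve[OF _ that] x by auto
  \<comment> \<open>The infimum of a constant over a nonempty family is that constant.\<close>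
  ultimately have "E_fun (\<lambda>z. \<bar>Im (artanh z)\<bar>) unit_disc (of_real x) (of_real \<xi>) = ereal (\<bar>\<xi>\<bar> / (1 - x\<^sup>2))"
    unfolding E_fun_def by simp
  then show "E_metric real_interval unit_disc (of_real x) (of_real \<xi>) = ereal (\<bar>\<xi>\<bar> / (1 - x\<^sup>2))"
    using E_metric_eq_E_fun_maximal[OF abs_Im_artanh_maximal] by simp
qed

end
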